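(* Fix $d>1$ and let $\delta_0$ be the unique root of $1-x=e^{-dx}$ in $(0,1)$. Let $G\sim G(n,d/n)$ and let $H\subseteq G$ be a largest connected component. Run the Random Growth process on $H$ starting at a vertex $v_1$ of $H$, modified so that it runs for $n$ steps (after the first time $t$ the queue is empty, the sets stay unchanged: $P_r=P_t$, $Q_r=Q_t$, $U_r=U_t$ for $t<r\leq n$). Then, as $n\to\infty$: for any $\pi\in(0,\delta_0)$ the expected density $|Q_t|/n$ at $t=\pi n$ converges to $1-\pi-\exp(-d\pi)$; for any $\pi\in(\delta_0,1]$ it converges to $0$.
   Context: $G(n,p)$ is the Erdős–Rényi random graph on $n$ vertices, each of the $\binom n2$ edges present independently with probability $p$. Random Growth process on a connected graph $H$ with start vertex $v_1$: maintain a partition of the vertex set into $P$ (processed), $Q$ (queue), $U$ (unvisited); initially $P=\emptyset$, $Q=\{v_1\}$, $U$ the remaining vertices. While $Q\neq\emptyset$: pick $v$ uniformly at random from $Q$; let $N$ be the neighbors of $v$ in $U$; set $P\leftarrow P\cup\{v\}$, $Q\leftarrow(Q\setminus\{v\})\cup N$, $U\leftarrow U\setminus N$. $Q_t$ is the queue after $t$ steps; densities are taken relative to $n$, the number of vertices of $G$. *)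

theory Defs
  imports "HOL-Probability.Probability"
begin

text \<open>Undirected graphs as pairs of a vertex set and a set of two-element edges.\<close>

type_synonym 'a ugraph = "'a set \<times> 'a set set"

abbreviation verts :: "'a ugraph \<Rightarrow> 'a set" where "verts G \<equiv> fst G"
abbreviation edges :: "'a ugraph \<Rightarrow> 'a set set" where "edges G \<equiv> snd G"

definition adj :: "'a ugraph \<Rightarrow> 'a \<Rightarrow> 'a \<Rightarrow> bool" where
  "adj G u v \<longleftrightarrow> {u, v} \<in> edges G"

definition induced_subgraph :: "'a ugraph \<Rightarrow> 'a set \<Rightarrow> 'a ugraph" where
  "induced_subgraph G W = (W, {e \<in> edges G. e \<subseteq> W})"

definition components :: "'a ugraph \<Rightarrow> 'a ugraph set" where
  "components G = {induced_subgraph G {u \<in> verts G. (adj G)\<^sup>*\<^sup>* v u} |v. v \<in> verts G}"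

definition largest_component :: "'a ugraph \<Rightarrow> 'a ugraph \<Rightarrow> bool" where
  "largest_component G H \<longleftrightarrow>
     H \<in> components G \<and> (\<forall>H' \<in> components G. card (verts H') \<le> card (verts H))"

definition all_edges :: "nat \<Rightarrow> nat set set" where
  "all_edges n = {{u, v} |u v. u < n \<and> v < n \<and> u \<noteq> v}"

text \<open>
  The Erdos-Renyi graph \<open>G(n,p)\<close>. Note that \<^const>\<open>bernoulli_pmf\<close> truncates its parameter
  to \<open>[0,1]\<close>, which for \<open>p = d/n\<close> only matters for the finitely many \<open>n < d\<close>.
\<close>

definition gnp :: "nat \<Rightarrow> real \<Rightarrow> nat ugraph pmf" where
  "gnp n p = map_pmf (\<lambda>f. ({..<n}, {e \<in> all_edges n. f e}))
     (Pi_pmf (all_edges n) False (\<lambda>_. bernoulli_pmf p))"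

text \<open>States of the Random Growth process are triples \<open>(P, Q, U)\<close>.\<close>

type_synonym 'a state = "'a set \<times> 'a set \<times> 'a set"

fun growth_step :: "'a ugraph \<Rightarrow> 'a state \<Rightarrow> 'a state pmf" where
  "growth_step H (P, Q, U) =
     (if Q = {} then return_pmf (P, Q, U)
      else map_pmf
             (\<lambda>v. let N = {w \<in> U. adj H v w} in (P \<union> {v}, (Q - {v}) \<union> N, U - N))
             (pmf_of_set Q))"

primrec random_growth :: "'a ugraph \<Rightarrow> 'a \<Rightarrow> nat \<Rightarrow> 'a state pmf" where
  "random_growth H v 0 = return_pmf ({}, {v}, verts H - {v})"
| "random_growth H v (Suc t) = bind_pmf (random_growth H v t) (growth_step H)"

text \<open>
  \<open>H\<close> and \<open>v\<close> select, from a sampled graph, the component and the start vertex.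
\<close>

definition expected_queue_density ::
  "nat \<Rightarrow> real \<Rightarrow> (nat ugraph \<Rightarrow> nat ugraph) \<Rightarrow> (nat ugraph \<Rightarrow> nat) \<Rightarrow> nat \<Rightarrow> real" where
  "expected_queue_density n p H v t =
     measure_pmf.expectation (bind_pmf (gnp n p) (\<lambda>G. random_growth (H G) (v G) t))
       (\<lambda>(P, Q, U). real (card Q) / real n)"

definition delta0 :: "real \<Rightarrow> real" where
  "delta0 d = (THE x. x \<in> {0<..<1} \<and> 1 - x = exp (- d * x))"

lemma delta0_ex1:
  fixes d :: real
  assumes d: "d > 1"
  shows "\<exists>!x. x \<in> {0<..<1} \<and> 1 - x = exp (- d * x)"
proof -
  define f where "f = (\<lambda>x::real. 1 - x - exp (- d * x))"
  have D: "(f has_real_derivative (d * exp (- d * x) - 1)) (at x)" for x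
    unfolding f_def by (auto intro!: derivative_eq_intros)
  have c: "continuous_on S f" for S
    unfolding f_def by (intro continuous_intros)
  have f0: "f 0 = 0" and f1: "f 1 < 0" by (simp_all add: f_def)
  have rolle: "\<exists>z. a < z \<and> z < b \<and> d * exp (- d * z) = 1"
    if "a < b" "f a = 0" "f b = 0" for a b
    using MVT2[of a b f "\<lambda>x. d * exp (- d * x) - 1"] D that by auto
  have uniq: "\<not> x < y" if xy: "0 < x" "f x = 0" "f y = 0" for x y
  proof
    assume "x < y"
    obtain a where a: "a < x" "d * exp (- d * a) = 1" using rolle[of 0 x] xy f0 by auto
    obtain b where b: "x < b" "d * exp (- d * b) = 1" using rolle[of x y] xy \<open>x < y\<close> by auto
    have "d * exp (- d * a) = d * exp (- d * b)" using a(2) b(2) by linarith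
    then have "a = b" using d by simp
    with a(1) b(1) show False by linarith
  qed
  obtain e where e: "e > 0" "\<And>h. h > 0 \<Longrightarrow> h < e \<Longrightarrow> f 0 < f (0 + h)"
    using DERIV_pos_inc_right[OF D[of 0]] d by auto
  define h where "h = min (e / 2) (1 / 2)"
  have h: "0 < h" "h < e" "h < 1" using e(1) by (auto simp: h_def min_def)
  have fh: "f h > 0" using e(2)[OF h(1,2)] f0 by simp
  obtain x where x: "h \<le> x" "x \<le> 1" "f x = 0"
    using IVT2'[of f 1 0 h] fh f1 h c by auto
  have "x \<noteq> 1" using x f1 by auto
  show ?thesis
  proof (rule ex1I[of _ x])
    show "x \<in> {0<..<1} \<and> 1 - x = exp (- d * x)"
      using x h \<open>x \<noteq> 1\<close> by (auto simp: f_def)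
    fix y assume "y \<in> {0<..<1} \<and> 1 - y = exp (- d * y)"
    then have "0 < y" "f y = 0" by (auto simp: f_def)
    then show "y = x" using uniq[of x y] uniq[of y x] x h by force
  qed
qed

end

theory Submission
  imports Defs "HOL-Real_Asymp.Real_Asymp"
begin

text \<open>
  Reveal an edge of \<open>G(n,p)\<close> only when the process inspects it. Each step keeps every unvisited
  vertex unvisited with probability \<open>1 - p\<close>, independently, so as long as the process is alive
  \<open>|U\<^sub>t|\<close> behaves like a binomial variable with success probability \<open>(1 - p)\<^sup>t\<close>, and Chernoff's
  method bounds its deviations by \<open>exp (- c n)\<close>. This is small enough for a union bound over all
  start vertices, which is needed because \<open>v\<^sub>1\<close> may depend on the graph.

  The same bound for the process started from the queue \<open>{0, \<dots>, k - 1}\<close> shows that with high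
  probability no such set reaches between \<open>\<epsilon> n\<close> and \<open>b n\<close> vertices, for \<open>b < \<delta>\<^sub>0\<close>. As \<open>k\<close> grows,
  the number of reached vertices goes from \<open>0\<close> to \<open>n\<close>, so it jumps over this gap; the jump is
  a component with more than \<open>(b - \<epsilon>) n\<close> vertices. Hence the process on the largest component
  survives \<open>\<pi> n\<close> steps for \<open>\<pi> < \<delta>\<^sub>0\<close>. For \<open>\<pi> > \<delta>\<^sub>0\<close> we have \<open>1 - \<pi> - exp (- d \<pi>) < 0\<close>,
  so a surviving process with a queue of linear size would be a large deviation.
\<close>

subsection \<open>The process under gradual exposure of the edges\<close>

text \<open>Recursion on the first step, opposite to \<open>random_growth\<close>: exposing the
  edges at the first chosen vertex leaves a shorter run from another state.\<close>

primrec run :: "'a ugraph \<Rightarrow> nat \<Rightarrow> 'a state \<Rightarrow> 'a state pmf" where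
  "run G 0 s = return_pmf s"
| "run G (Suc t) s = bind_pmf (growth_step G s) (run G t)"

lemma run_Suc_back: "run G (Suc t) s = bind_pmf (run G t s) (growth_step G)"
proof (induction t arbitrary: s)
  case (Suc t)
  have "run G (Suc (Suc t)) s = bind_pmf (growth_step G s) (\<lambda>s'. bind_pmf (run G t s') (growth_step G))"
    by (subst run.simps(2)) (intro bind_pmf_cong refl Suc)
  also have "\<dots> = bind_pmf (run G (Suc t) s) (growth_step G)"
    by (simp add: bind_assoc_pmf)
  finally show ?case .
next
  case 0
  have "run G 0 = return_pmf" by (simp add: fun_eq_iff)
  then show ?case by (simp add: bind_return_pmf bind_return_pmf')
qed

lemma random_growth_eq_run: "random_growth G v t = run G t ({}, {v}, verts G - {v})"
proof (induction t)
  case (Suc t)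
  then show ?case by (simp add: run_Suc_back del: run.simps(2))
qed simp

lemma run_empty_queue: "run G t (P, {}, U) = return_pmf (P, {}, U)"
  by (induction t) (simp_all add: bind_return_pmf)

definition nbrs :: "'a ugraph \<Rightarrow> 'a \<Rightarrow> 'a set \<Rightarrow> 'a set" where
  "nbrs G v U = {w \<in> U. adj G v w}"

lemma run_Suc_queue:
  assumes "Q \<noteq> {}"
  shows "run G (Suc t) (P, Q, U) =
    bind_pmf (pmf_of_set Q)
      (\<lambda>v. run G t (insert v P, Q - {v} \<union> nbrs G v U, U - nbrs G v U))"
  using assms by (simp add: map_pmf_def bind_assoc_pmf bind_return_pmf Let_def nbrs_def)

text \<open>A run asks only for pairs with one end in \<open>Q \<union> U\<close> and the other in
  \<open>U\<close>, and both sets only shrink along the run. Hence edges inspected earlier can be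
  changed without changing its law.\<close>

lemma run_cong:
  assumes "finite Q" "finite U"
    and "\<And>q u. q \<in> Q \<union> U \<Longrightarrow> u \<in> U \<Longrightarrow> adj G q u = adj G' q u"
  shows "run G t (P, Q, U) = run G' t (P, Q, U)"
  using assms
proof (induction t arbitrary: P Q U)
  case (Suc t)
  show ?case
  proof (cases "Q = {}")
    case False
    have "run G t (insert v P, Q - {v} \<union> nbrs G v U, U - nbrs G v U) =
          run G' t (insert v P, Q - {v} \<union> nbrs G' v U, U - nbrs G' v U)" if "v \<in> Q" for v
    proof -
      have N: "nbrs G v U = nbrs G' v U" using Suc.prems(3) that by (auto simp: nbrs_def)
      show ?thesis unfolding N
        using Suc.prems by (intro Suc.IH) (auto simp: nbrs_def)
    qed
    then show ?thesis using False Suc.prems(1)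
      unfolding run_Suc_queue[OF False] by (intro bind_pmf_cong) auto
  qed (simp only: run_empty_queue)
qed simp

text \<open>The exponential moment \<open>z ^ card U\<close> of Chernoff's method, cut off on runs
  that stopped early, because these no longer thin out the unvisited vertices.\<close>

definition alive_weight :: "real \<Rightarrow> nat \<Rightarrow> 'a state \<Rightarrow> ennreal" where
  "alive_weight z k s = (if card (fst s) = k then ennreal (z ^ card (snd (snd s))) else 0)"

text \<open>Each pair \<open>{v, u}\<close> contributes the factor 1 if it is an edge and
  \<open>y\<close> if not, with mean \<open>p + (1 - p) * y\<close>; independence multiplies the
  means.\<close>

lemma nn_integral_unvisited:
  fixes p y :: real
  assumes "finite U" "v \<notin> U" "0 \<le> p" "p \<le> 1" "0 \<le> y"
  defines "A \<equiv> (\<lambda>u. {v, u}) ` U"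
  shows "(\<integral>\<^sup>+f. ennreal (y ^ card {u \<in> U. \<not> f {v, u}})
           \<partial>Pi_pmf A False (\<lambda>_. bernoulli_pmf p)) = ennreal ((p + (1 - p) * y) ^ card U)"
proof -
  have inj: "inj_on (\<lambda>u. {v, u}) U" using assms(2) by (auto simp: inj_on_def doubleton_eq_iff)
  have "y ^ card {u \<in> U. \<not> f {v, u}} = (\<Prod>e\<in>A. if f e then 1 else y)" for f
  proof -
    have "(\<Prod>e\<in>A. if f e then 1 else y) = (\<Prod>u\<in>U. if \<not> f {v, u} then y else 1)"
      unfolding A_def by (subst prod.reindex[OF inj]) (auto intro: prod.cong)
    also have "\<dots> = (\<Prod>u\<in>{u \<in> U. \<not> f {v, u}}. y)"
      using assms(1) by (rule prod.inter_filter[symmetric])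
    finally show ?thesis by simp
  qed
  then have "(\<integral>\<^sup>+f. ennreal (y ^ card {u \<in> U. \<not> f {v, u}})
           \<partial>Pi_pmf A False (\<lambda>_. bernoulli_pmf p)) =
        (\<integral>\<^sup>+f. (\<Prod>e\<in>A. ennreal (if f e then 1 else y)) \<partial>Pi_pmf A False (\<lambda>_. bernoulli_pmf p))"
    using assms by (subst prod_ennreal) auto
  also have "\<dots> = (\<Prod>e\<in>A. \<integral>\<^sup>+b. ennreal (if b then 1 else y) \<partial>bernoulli_pmf p)"
    using assms by (intro nn_integral_prod_Pi_pmf) (auto simp: A_def)
  also have "(\<integral>\<^sup>+b. ennreal (if b then 1 else y) \<partial>bernoulli_pmf p) = ennreal (p + (1 - p) * y)"
    using assms by (simp flip: ennreal_mult ennreal_1)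
  also have "(\<Prod>e\<in>A. ennreal (p + (1 - p) * y)) = ennreal ((p + (1 - p) * y) ^ card U)"
    using assms inj by (simp add: A_def card_image ennreal_power flip: ennreal_plus)
  finally show ?thesis .
qed

text \<open>
  The edges between \<open>v\<close> and \<open>U\<close> determine the step at \<open>v\<close> and are never inspected again, so the
  rest of the run only depends on the independent remaining edges.
\<close>
lemma nn_integral_run_step_le:
  fixes G :: "('a set \<Rightarrow> bool) \<Rightarrow> 'a ugraph"
  assumes p: "0 \<le> p" "p \<le> 1" and y: "0 \<le> y" and fin: "finite A" "finite Q" "finite U"
    and QU: "Q \<inter> U = {}" and v: "v \<in> Q"
    and A: "\<And>u. u \<in> U \<Longrightarrow> {v, u} \<in> A"
    and le: "\<And>N. N \<subseteq> U \<Longrightarrow> (\<integral>\<^sup>+f. \<integral>\<^sup>+s. \<phi> s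
          \<partial>run (V, {e \<in> A - (\<lambda>u. {v, u}) ` U. f e}) t (insert v P, Q - {v} \<union> N, U - N)
          \<partial>Pi_pmf (A - (\<lambda>u. {v, u}) ` U) False (\<lambda>_. bernoulli_pmf p)) \<le> ennreal (y ^ card (U - N))"
  defines "G \<equiv> \<lambda>f. (V, {e \<in> A. f e})"
  shows "(\<integral>\<^sup>+f. \<integral>\<^sup>+s. \<phi> s
            \<partial>run (G f) t (insert v P, Q - {v} \<union> nbrs (G f) v U, U - nbrs (G f) v U)
            \<partial>Pi_pmf A False (\<lambda>_. bernoulli_pmf p)) \<le> ennreal ((p + (1 - p) * y) ^ card U)"
proof -
  define A1 where "A1 = (\<lambda>u. {v, u}) ` U"
  define A2 where "A2 = A - A1"
  define B where "B = (\<lambda>A. Pi_pmf A False (\<lambda>_::'a set. bernoulli_pmf p))"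
  define h where "h = (\<lambda>f g (x :: 'a set). if x \<in> A1 then f x else g x :: bool)"
  define N where "N = (\<lambda>f. {u \<in> U. f {v, u}})"
  have [simp]: "finite A1" "finite A2" using fin by (auto simp: A1_def A2_def)
  have sub: "A1 \<subseteq> A" using A by (auto simp: A1_def)
  have vU: "v \<notin> U" using QU v by auto
  have "Pi_pmf A False (\<lambda>_. bernoulli_pmf p) = map_pmf (\<lambda>(f, g). h f g) (pair_pmf (B A1) (B A2))"
    using Pi_pmf_union[of A1 A2 False "\<lambda>_. bernoulli_pmf p"] sub
    unfolding B_def h_def A2_def by (simp add: Un_absorb1 fin A1_def)
  then have "(\<integral>\<^sup>+f. \<integral>\<^sup>+s. \<phi> s
            \<partial>run (G f) t (insert v P, Q - {v} \<union> nbrs (G f) v U, U - nbrs (G f) v U)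
            \<partial>Pi_pmf A False (\<lambda>_. bernoulli_pmf p)) =
       (\<integral>\<^sup>+f. \<integral>\<^sup>+g. \<integral>\<^sup>+s. \<phi> s
            \<partial>run (G (h f g)) t (insert v P, Q - {v} \<union> nbrs (G (h f g)) v U, U - nbrs (G (h f g)) v U)
            \<partial>B A2 \<partial>B A1)"
    by (simp add: nn_integral_pair_pmf')
  also have "\<dots> = (\<integral>\<^sup>+f. \<integral>\<^sup>+g. \<integral>\<^sup>+s. \<phi> s
            \<partial>run (V, {e \<in> A2. g e}) t (insert v P, Q - {v} \<union> N f, U - N f) \<partial>B A2 \<partial>B A1)"
  proof (intro nn_integral_cong arg_cong[where f = "\<lambda>M. \<integral>\<^sup>+s. \<phi> s \<partial>measure_pmf M"])
    fix f g
    have N: "nbrs (G (h f g)) v U = N f"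
      using sub by (auto simp: nbrs_def N_def G_def adj_def h_def A1_def)
    show "run (G (h f g)) t (insert v P, Q - {v} \<union> nbrs (G (h f g)) v U, U - nbrs (G (h f g)) v U) =
      run (V, {e \<in> A2. g e}) t (insert v P, Q - {v} \<union> N f, U - N f)"
      unfolding N
    proof (rule run_cong)
      fix q u assume "q \<in> Q - {v} \<union> N f \<union> (U - N f)" "u \<in> U - N f"
      \<comment> \<open>Every pair in \<open>A1\<close> contains \<open>v\<close>, which has left
        the queue and is not in \<open>U\<close>.\<close>
      then have "{q, u} \<notin> A1" using vU by (auto simp: A1_def N_def doubleton_eq_iff)
      then show "adj (G (h f g)) q u = adj (V, {e \<in> A2. g e}) q u"
        by (auto simp: adj_def G_def h_def A2_def)
    qed (use fin in \<open>auto simp: N_def\<close>)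
  qed
  also have "\<dots> \<le> (\<integral>\<^sup>+f. ennreal (y ^ card {u \<in> U. \<not> f {v, u}}) \<partial>B A1)"
  proof (rule nn_integral_mono)
    fix f
    have "U - N f = {u \<in> U. \<not> f {v, u}}" by (auto simp: N_def)
    with le[of "N f"] show "(\<integral>\<^sup>+g. \<integral>\<^sup>+s. \<phi> s
            \<partial>run (V, {e \<in> A2. g e}) t (insert v P, Q - {v} \<union> N f, U - N f) \<partial>B A2)
         \<le> ennreal (y ^ card {u \<in> U. \<not> f {v, u}})"
      by (auto simp: N_def A1_def A2_def B_def)
  qed
  also have "\<dots> = ennreal ((p + (1 - p) * y) ^ card U)"
    unfolding B_def A1_def using p y vU fin by (intro nn_integral_unvisited) auto
  finally show ?thesis .
qed

text \<open>
  The right-hand side is the probability generating function at \<open>z\<close> of the binomial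
  distribution with parameters \<open>card U\<close> and \<open>(1 - p) ^ t\<close>. The run has processed \<open>t\<close> further
  vertices exactly if its queue was not empty before step \<open>t\<close>.
\<close>
lemma nn_integral_alive_weight_le:
  fixes p z :: real
  assumes p: "0 \<le> p" "p \<le> 1" and z: "0 \<le> z"
    and "finite A" "finite P" "finite Q" "finite U"
    and "P \<inter> Q = {}" "P \<inter> U = {}" "Q \<inter> U = {}"
    and "\<And>q u. q \<in> Q \<union> U \<Longrightarrow> u \<in> U \<Longrightarrow> q \<noteq> u \<Longrightarrow> {q, u} \<in> A"
  shows "(\<integral>\<^sup>+f. \<integral>\<^sup>+s. alive_weight z (card P + t) s \<partial>run (V, {e \<in> A. f e}) t (P, Q, U)
           \<partial>Pi_pmf A False (\<lambda>_. bernoulli_pmf p))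
         \<le> ennreal ((1 + (1 - p) ^ t * (z - 1)) ^ card U)"
  using assms(4-)
proof (induction t arbitrary: A P Q U)
  case 0
  then show ?case by (simp add: alive_weight_def)
next
  case (Suc t)
  show ?case
  proof (cases "Q = {}")
    case True
    then show ?thesis
      by (simp add: run_empty_queue alive_weight_def del: run.simps(2))
  next
    case False
    define y where "y = 1 + (1 - p) ^ t * (z - 1)"
    define B where "B = Pi_pmf A False (\<lambda>_::'a set. bernoulli_pmf p)"
    define G where "G = (\<lambda>f. (V, {e \<in> A. f e}))"
    define \<phi> where "\<phi> = (alive_weight z (card P + Suc t) :: 'a state \<Rightarrow> ennreal)"
    have "(1 - p) ^ t \<le> 1" "(1 - p) ^ t \<ge> 0" using p by (auto intro: power_le_one)
    then have "(1 - p) ^ t * (1 - z) \<le> 1 * 1" using z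
      by (cases "z \<le> 1") (intro mult_mono, auto, smt (verit) mult_nonneg_nonpos)
    then have y: "0 \<le> y" by (simp add: y_def algebra_simps)
    \<comment> \<open>One more step replaces \<open>y\<close> by \<open>p + (1 - p) * y\<close>, a
      map that fixes 1 and scales the distance to 1 by \<open>1 - p\<close>.\<close>
    have yp: "p + (1 - p) * y = 1 + (1 - p) ^ Suc t * (z - 1)"
      by (simp add: y_def algebra_simps)
    have "(\<integral>\<^sup>+f. \<integral>\<^sup>+s. \<phi> s \<partial>run (G f) (Suc t) (P, Q, U) \<partial>B) =
      (\<integral>\<^sup>+v. \<integral>\<^sup>+f. \<integral>\<^sup>+s. \<phi> s
         \<partial>run (G f) t (insert v P, Q - {v} \<union> nbrs (G f) v U, U - nbrs (G f) v U) \<partial>B \<partial>pmf_of_set Q)"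
      \<comment> \<open>The queue is not random here, so \<open>v\<close> can be drawn before the
        edges.\<close>
      using False unfolding nn_integral_bind_pmf[symmetric]
      by (subst bind_commute_pmf) (simp add: run_Suc_queue del: run.simps(2) nn_integral_bind_pmf)
    also have "\<dots> \<le> (\<integral>\<^sup>+v. ennreal ((p + (1 - p) * y) ^ card U) \<partial>pmf_of_set Q)"
    proof (rule nn_integral_mono_AE, unfold AE_measure_pmf_iff, rule ballI)
      fix v assume "v \<in> set_pmf (pmf_of_set Q)"
      then have v: "v \<in> Q" using False Suc.prems by simp
      show "(\<integral>\<^sup>+f. \<integral>\<^sup>+s. \<phi> s
         \<partial>run (G f) t (insert v P, Q - {v} \<union> nbrs (G f) v U, U - nbrs (G f) v U) \<partial>B)
         \<le> ennreal ((p + (1 - p) * y) ^ card U)"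
        unfolding G_def B_def
      proof (rule nn_integral_run_step_le)
        show "{v, u} \<in> A" if "u \<in> U" for u using that v Suc.prems by blast
      next
        fix N assume N: "N \<subseteq> U"
        let ?A = "A - (\<lambda>u. {v, u}) ` U"
        have "v \<notin> P" "v \<notin> U" using v Suc.prems by auto
        then have "\<phi> = alive_weight z (card (insert v P) + t)"
          using Suc.prems by (simp add: \<phi>_def)
        then show "(\<integral>\<^sup>+f. \<integral>\<^sup>+s. \<phi> s
            \<partial>run (V, {e \<in> ?A. f e}) t (insert v P, Q - {v} \<union> N, U - N)
            \<partial>Pi_pmf ?A False (\<lambda>_. bernoulli_pmf p)) \<le> ennreal (y ^ card (U - N))"
          unfolding y_def
          using Suc.prems N \<open>v \<notin> U\<close> finite_subset[OF N]
          by (simp only:) (rule Suc.IH, auto simp: doubleton_eq_iff)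
      qed (use p y v Suc.prems in auto)
    qed
    also have "\<dots> = ennreal ((1 + (1 - p) ^ Suc t * (z - 1)) ^ card U)"
      by (simp only: yp) simp
    finally show ?thesis by (simp only: \<phi>_def G_def B_def)
  qed
qed

subsection \<open>Large deviations of the number of unvisited vertices\<close>

text \<open>The start set is fixed before the graph is drawn, so that no edge is exposed at time 0.
  The run takes place in the whole graph, not in a component.\<close>

definition exploration :: "nat \<Rightarrow> real \<Rightarrow> nat set \<Rightarrow> nat \<Rightarrow> nat state pmf" where
  "exploration n p S t = bind_pmf (gnp n p) (\<lambda>G. run G t ({}, S, {..<n} - S))"

lemma finite_all_edges [simp]: "finite (all_edges n)"
  by (rule finite_subset[of _ "Pow {..<n}"]) (auto simp: all_edges_def)

lemma nn_integral_exploration_le: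
  assumes "0 \<le> p" "p \<le> 1" "0 \<le> z" "S \<subseteq> {..<n}"
  shows "(\<integral>\<^sup>+s. alive_weight z t s \<partial>exploration n p S t)
         \<le> ennreal ((1 + (1 - p) ^ t * (z - 1)) ^ (n - card S))"
proof -
  have "finite S" using assms(4) finite_subset by blast
  then have "(\<integral>\<^sup>+f. \<integral>\<^sup>+s. alive_weight z (card ({} :: nat set) + t) s
      \<partial>run ({..<n}, {e \<in> all_edges n. f e}) t ({}, S, {..<n} - S)
      \<partial>Pi_pmf (all_edges n) False (\<lambda>_. bernoulli_pmf p))
      \<le> ennreal ((1 + (1 - p) ^ t * (z - 1)) ^ card ({..<n} - S))"
    using assms by (intro nn_integral_alive_weight_le finite_all_edges) (auto simp: all_edges_def)
  then show ?thesis
    using assms by (simp add: exploration_def gnp_def card_Diff_subset \<open>finite S\<close>)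
qed

text \<open>Markov's inequality for the weight \<open>w\<close> with threshold \<open>c\<close> on
  \<open>X\<close>.\<close>

lemma emeasure_le_nn_integral:
  fixes M :: "'a pmf"
  assumes "(\<integral>\<^sup>+s. w s \<partial>M) \<le> ennreal a" "\<And>s. s \<in> X \<Longrightarrow> ennreal c \<le> w s"
    and "c > 0" "b \<ge> 0" "a \<le> c * b"
  shows "emeasure M X \<le> ennreal b"
proof -
  have "ennreal c * emeasure M X = (\<integral>\<^sup>+s. ennreal c * indicator X s \<partial>M)"
    by (simp add: nn_integral_cmult)
  also have "\<dots> \<le> (\<integral>\<^sup>+s. w s \<partial>M)"
    using assms(2) by (intro nn_integral_mono) (auto simp: indicator_def)
  also have "\<dots> \<le> ennreal (c * b)" using assms(1,5) by (meson ennreal_leI order_trans)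
  also have "\<dots> = ennreal c * ennreal b" using assms by (simp add: ennreal_mult)
  finally show ?thesis using assms(3) by (simp add: ennreal_mult_le_mult_iff)
qed

text \<open>Chernoff's method with \<open>z = 1 + x\<close>. The base \<open>1 + q * x\<close> is at
  least 1, so the exponent \<open>n - card S\<close> can be raised to \<open>n\<close> and the bound
  is uniform over all start sets.\<close>

lemma exploration_upper_tail:
  fixes n t :: nat and p \<eta> :: real
  assumes p: "0 \<le> p" "p \<le> 1" and S: "S \<subseteq> {..<n}" and \<eta>: "0 < \<eta>" "\<eta> \<le> 1"
  shows "emeasure (measure_pmf (exploration n p S t))
           {(P, Q, U). card P = t \<and> real (card U) \<ge> real n * ((1 - p) ^ t + \<eta>)}
         \<le> ennreal (exp (- (real n * \<eta>\<^sup>2 / 8)))"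
proof (rule emeasure_le_nn_integral)
  define q where "q = (1 - p) ^ t"
  have q: "0 \<le> q" "q \<le> 1" using p by (auto simp: q_def intro: power_le_one)
  \<comment> \<open>With \<open>ln (1 + x) \<ge> x - x\<^sup>2\<close> and
    \<open>q + \<eta> \<le> 2\<close>, the exponent per vertex is at most
    \<open>2 * x\<^sup>2 - \<eta> * x\<close>, minimal at \<open>\<eta> / 4\<close> with value
    \<open>- \<eta>\<^sup>2 / 8\<close>.\<close>
  define x where "x = \<eta> / 4"
  have x: "0 < x" "x \<le> 1" using \<eta> by (auto simp: x_def)
  have \<eta>_eq: "\<eta> = 4 * x" by (simp add: x_def)
  define c where "c = (1 + x) powr (real n * (q + \<eta>))"
  show "(\<integral>\<^sup>+s. alive_weight (1 + x) t s \<partial>exploration n p S t) \<le> ennreal ((1 + q * x) ^ (n - card S))"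
    using nn_integral_exploration_le[OF p, of "1 + x" S n t] S x by (simp add: q_def)
  show "ennreal c \<le> alive_weight (1 + x) t s"
    if "s \<in> {(P, Q, U). card P = t \<and> real (card U) \<ge> real n * ((1 - p) ^ t + \<eta>)}" for s
  proof -
    obtain P Q U where s: "s = (P, Q, U)" using prod_cases3 by blast
    have "c \<le> (1 + x) powr card U" unfolding c_def
      using that x by (intro powr_mono) (auto simp: s q_def)
    also have "\<dots> = (1 + x) ^ card U" using x by (intro powr_realpow) auto
    finally show ?thesis using that by (auto simp: s alive_weight_def intro!: ennreal_leI)
  qed
  show "c > 0" using x by (simp add: c_def)
  have "(1 + q * x) ^ (n - card S) \<le> (1 + q * x) ^ n"
    using q x by (intro power_increasing) auto
  also have "\<dots> \<le> exp (q * x) ^ n" using q x by (intro power_mono) auto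
  also have "\<dots> = exp (real n * (q * x))" by (simp add: exp_of_nat_mult)
  also have "\<dots> \<le> exp (real n * (q + \<eta>) * (x - x\<^sup>2) - real n * \<eta>\<^sup>2 / 8)"
  proof -
    have "(q + \<eta>) * x\<^sup>2 \<le> 2 * x\<^sup>2" using q \<eta> by (intro mult_right_mono) auto
    then have "q * x \<le> (q + \<eta>) * (x - x\<^sup>2) - \<eta>\<^sup>2 / 8"
      by (simp add: \<eta>_eq algebra_simps power2_eq_square)
    then have "real n * (q * x) \<le> real n * ((q + \<eta>) * (x - x\<^sup>2) - \<eta>\<^sup>2 / 8)"
      by (intro mult_left_mono) auto
    then show ?thesis by (simp add: algebra_simps)
  qed
  also have "\<dots> \<le> exp (real n * (q + \<eta>) * ln (1 + x) - real n * \<eta>\<^sup>2 / 8)"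
    using ln_one_plus_pos_lower_bound[of x] x q \<eta> by (auto intro!: mult_left_mono)
  also have "\<dots> = c * exp (- (real n * \<eta>\<^sup>2 / 8))"
    using x by (simp add: c_def powr_def flip: exp_add)
  finally show "(1 + q * x) ^ (n - card S) \<le> c * exp (- (real n * \<eta>\<^sup>2 / 8))" .
qed auto

text \<open>The same method with \<open>z = 1 - x\<close>. Now the base is at most 1, so the start
  vertex missing from \<open>U\<close> costs a factor, which accounts for the 1 in the
  exponent.\<close>

lemma exploration_lower_tail:
  fixes n t :: nat and p \<eta> :: real
  assumes p: "0 \<le> p" "p \<le> 1" and v: "v < n" and \<eta>: "0 < \<eta>" "\<eta> \<le> 1"
  shows "emeasure (measure_pmf (exploration n p {v} t))
           {(P, Q, U). card P = t \<and> real (card U) \<le> real n * ((1 - p) ^ t - \<eta>)}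
         \<le> ennreal (exp (1 - real n * \<eta>\<^sup>2 / 8))"
proof (cases "\<eta> \<le> (1 - p) ^ t")
  \<comment> \<open>The threshold for \<open>card U\<close> is negative, so the event is
    empty.\<close>
  case False
  then have "real n * ((1 - p) ^ t - \<eta>) < 0" using v by (intro mult_pos_neg) auto
  then have "\<not> real k \<le> real n * ((1 - p) ^ t - \<eta>)" for k by linarith
  then have "{(P, Q, U). card P = t \<and> real (card U) \<le> real n * ((1 - p) ^ t - \<eta>)} = ({} :: nat state set)"
    by auto
  then show ?thesis by (simp only: emeasure_empty zero_le)
next
  case True
  define q where "q = (1 - p) ^ t"
  have q: "\<eta> \<le> q" "q \<le> 1" using p True by (auto simp: q_def intro: power_le_one)
  define x where "x = \<eta> / 4"
  have x: "0 < x" "x \<le> 1 / 4" using \<eta> by (auto simp: x_def)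
  have \<eta>_eq: "\<eta> = 4 * x" by (simp add: x_def)
  define c where "c = (1 - x) powr (real n * (q - \<eta>))"
  show ?thesis
  proof (rule emeasure_le_nn_integral)
    show "(\<integral>\<^sup>+s. alive_weight (1 - x) t s \<partial>exploration n p {v} t) \<le> ennreal ((1 - q * x) ^ (n - 1))"
      using nn_integral_exploration_le[OF p, of "1 - x" "{v}" n t] v x by (simp add: q_def)
    show "ennreal c \<le> alive_weight (1 - x) t s"
      if "s \<in> {(P, Q, U). card P = t \<and> real (card U) \<le> real n * ((1 - p) ^ t - \<eta>)}" for s
    proof -
      obtain P Q U where s: "s = (P, Q, U)" using prod_cases3 by blast
      have "c \<le> (1 - x) powr card U" unfolding c_def
        using that x by (intro powr_mono') (auto simp: s q_def)
      also have "\<dots> = (1 - x) ^ card U" using x by (intro powr_realpow) auto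
      finally show ?thesis using that by (auto simp: s alive_weight_def intro!: ennreal_leI)
    qed
    show "c > 0" using x by (simp add: c_def)
    have qx: "q * x \<le> 1" using q x by (intro mult_le_one) auto
    then have "(1 - q * x) ^ (n - 1) \<le> exp (- (q * x)) ^ (n - 1)"
      using exp_ge_add_one_self[of "- (q * x)"] by (intro power_mono) auto
    also have "\<dots> = exp (- (real (n - 1) * (q * x)))"
      by (simp flip: exp_of_nat_mult)
    also have "\<dots> \<le> exp (real n * (q - \<eta>) * (- x - 2 * x\<^sup>2) + (1 - real n * \<eta>\<^sup>2 / 8))"
    proof -
      have "2 * (q - \<eta>) * x\<^sup>2 \<le> 2 * x\<^sup>2" using q \<eta> by (intro mult_right_mono) auto
      then have "- (q * x) \<le> (q - \<eta>) * (- x - 2 * x\<^sup>2) - \<eta>\<^sup>2 / 8"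
        by (simp add: \<eta>_eq algebra_simps power2_eq_square)
      then have "real n * (- (q * x)) \<le> real n * ((q - \<eta>) * (- x - 2 * x\<^sup>2) - \<eta>\<^sup>2 / 8)"
        by (intro mult_left_mono) auto
      \<comment> \<open>The lost factor is \<open>exp (q * x)\<close>, at most \<open>exp 1\<close>
        because \<open>q * x \<le> 1\<close>.\<close>
      moreover have "real (n - 1) = real n - 1" using v by auto
      ultimately show ?thesis using qx by (simp add: algebra_simps)
    qed
    also have "\<dots> \<le> exp (real n * (q - \<eta>) * ln (1 - x) + (1 - real n * \<eta>\<^sup>2 / 8))"
      using ln_one_minus_pos_lower_bound[of x] x q \<eta> by (auto intro!: mult_left_mono)
    also have "\<dots> = c * exp (1 - real n * \<eta>\<^sup>2 / 8)"
      using x by (simp add: c_def powr_def flip: exp_add)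
    finally show "(1 - q * x) ^ (n - 1) \<le> c * exp (1 - real n * \<eta>\<^sup>2 / 8)" .
  qed auto
qed

subsection \<open>Reachability and components\<close>

definition reach :: "'a ugraph \<Rightarrow> 'a set \<Rightarrow> 'a set" where
  "reach G S = {u. \<exists>s\<in>S. (adj G)\<^sup>*\<^sup>* s u}"

lemma subset_reach: "S \<subseteq> reach G S"
  by (auto simp: reach_def)

lemma reach_insert: "reach G (insert v S) = reach G {v} \<union> reach G S"
  by (auto simp: reach_def)

lemma reach_empty [simp]: "reach G {} = {}"
  by (auto simp: reach_def)

lemma reach_step: "u \<in> reach G S \<Longrightarrow> adj G u w \<Longrightarrow> w \<in> reach G S"
  by (auto simp: reach_def intro: rtranclp.rtrancl_into_rtrancl)

lemma reach_subset_closed: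
  assumes "S \<subseteq> W" "\<And>u w. u \<in> W \<Longrightarrow> adj G u w \<Longrightarrow> w \<in> W"
  shows "reach G S \<subseteq> W"
proof
  fix u assume "u \<in> reach G S"
  then obtain s where "s \<in> S" "(adj G)\<^sup>*\<^sup>* s u" by (auto simp: reach_def)
  from this(2) show "u \<in> W" by induction (use assms \<open>s \<in> S\<close> in auto)
qed

definition graph_on :: "'a set \<Rightarrow> 'a ugraph \<Rightarrow> bool" where
  "graph_on V G \<longleftrightarrow> finite V \<and> verts G = V \<and> (\<forall>u w. adj G u w \<longrightarrow> u \<in> V \<and> w \<in> V)"

text \<open>Neighbours of processed vertices have been visited, so \<open>P\<close> is closed under
  adjacency once the queue is empty. The last clause records that steps are lost only through an
  empty queue.\<close>

definition growth_inv :: "'a ugraph \<Rightarrow> 'a set \<Rightarrow> 'a set \<Rightarrow> nat \<Rightarrow> 'a state \<Rightarrow> bool" where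
  "growth_inv G V S t = (\<lambda>(P, Q, U).
     P \<union> Q \<union> U = V \<and> P \<inter> Q = {} \<and> (P \<union> Q) \<inter> U = {} \<and> S \<subseteq> P \<union> Q \<and> P \<union> Q \<subseteq> reach G S \<and>
     (\<forall>v\<in>P. \<forall>w. adj G v w \<longrightarrow> w \<in> P \<union> Q) \<and> (Q = {} \<or> card P = t))"

lemma growth_inv_run:
  assumes G: "graph_on V G" and S: "S \<subseteq> V"
  shows "s \<in> set_pmf (run G t ({}, S, V - S)) \<Longrightarrow> growth_inv G V S t s \<and> card (fst s) \<le> t"
proof (induction t arbitrary: s)
  case 0
  then show ?case using S subset_reach[of S G] by (auto simp: growth_inv_def)
next
  case (Suc t)
  then obtain P Q U where s0: "(P, Q, U) \<in> set_pmf (run G t ({}, S, V - S))"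
    and s: "s \<in> set_pmf (growth_step G (P, Q, U))"
    unfolding run_Suc_back by auto
  from Suc.IH[OF s0] have inv: "growth_inv G V S t (P, Q, U)" and "card P \<le> t" by auto
  show ?case
  proof (cases "Q = {}")
    case True
    then show ?thesis using s inv \<open>card P \<le> t\<close> by (auto simp: growth_inv_def)
  next
    case False
    have fin: "finite P" "finite Q" using inv G unfolding graph_on_def
      by (auto simp: growth_inv_def)
    obtain v where v: "v \<in> Q"
      and s': "s = (insert v P, Q - {v} \<union> {w \<in> U. adj G v w}, U - {w \<in> U. adj G v w})"
      using s False fin by (auto simp: Let_def)
    have "v \<in> reach G S" and "v \<notin> P" and "card P = t"
      using inv v False by (auto simp: growth_inv_def)
    have adjV: "w \<in> V" if "adj G v w" for w using that G by (auto simp: graph_on_def)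
    have "growth_inv G V S (Suc t) s" unfolding s' growth_inv_def prod.case
    proof (intro conjI ballI allI impI)
      show "insert v P \<union> (Q - {v} \<union> {w \<in> U. adj G v w}) \<subseteq> reach G S"
        using inv v \<open>v \<in> reach G S\<close> reach_step[of v G S] by (auto simp: growth_inv_def)
      fix u w assume "u \<in> insert v P" "adj G u w"
      then show "w \<in> insert v P \<union> (Q - {v} \<union> {w \<in> U. adj G v w})"
        using inv v adjV[of w] by (auto simp: growth_inv_def)
    qed (use inv v fin \<open>card P = t\<close> \<open>v \<notin> P\<close> in \<open>auto simp: growth_inv_def\<close>)
    then show ?thesis using fin \<open>card P = t\<close> \<open>v \<notin> P\<close> by (simp add: s')
  qed
qed

text \<open>A run that has processed fewer than \<open>t\<close> vertices has an empty queue, so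
  \<open>P\<close> is closed and contains all of \<open>reach G S\<close>, which is too
  large.\<close>

lemma run_alive:
  assumes G: "graph_on V G" and S: "S \<subseteq> V" and s: "(P, Q, U) \<in> set_pmf (run G t ({}, S, V - S))"
    and t: "t \<le> card (reach G S)"
  shows "card P = t"
proof (rule ccontr)
  assume "card P \<noteq> t"
  moreover have inv: "growth_inv G V S t (P, Q, U)" "card P \<le> t"
    using growth_inv_run[OF G S s] by auto
  ultimately have "Q = {}" "card P < t" by (auto simp: growth_inv_def)
  with inv have "reach G S \<subseteq> P"
    by (intro reach_subset_closed) (auto simp: growth_inv_def)
  moreover have "finite P" using inv G by (auto simp: growth_inv_def graph_on_def)
  ultimately have "card (reach G S) \<le> card P" by (intro card_mono)
  then show False using t \<open>card P < t\<close> by simp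
qed

lemma run_card:
  assumes G: "graph_on V G" and S: "S \<subseteq> V" and s: "(P, Q, U) \<in> set_pmf (run G t ({}, S, V - S))"
  shows "card P + card Q + card U = card V" "card P = t \<or> Q = {}"
proof -
  have inv: "growth_inv G V S t (P, Q, U)" using growth_inv_run[OF G S s] by auto
  then show "card P = t \<or> Q = {}" by (auto simp: growth_inv_def)
  have V: "V = P \<union> Q \<union> U" "P \<inter> Q = {}" "(P \<union> Q) \<inter> U = {}"
    using inv by (auto simp: growth_inv_def)
  then have "finite P" "finite Q" "finite U" using G by (auto simp: graph_on_def)
  then show "card P + card Q + card U = card V" using V by (simp add: card_Un_disjoint)
qed

text \<open>At this time the run has processed all of \<open>reach G S\<close>, whatever its choices
  were. The size of the reached set can thus be read off \<open>card U\<close>, to which the tail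
  bounds apply.\<close>

lemma run_exhausted:
  assumes G: "graph_on V G" and S: "S \<subseteq> V"
    and s: "(P, Q, U) \<in> set_pmf (run G (card (reach G S)) ({}, S, V - S))"
  shows "card P = card (reach G S)" "card U = card V - card (reach G S)"
proof -
  show P: "card P = card (reach G S)" using run_alive[OF G S s] by simp
  have inv: "growth_inv G V S (card (reach G S)) (P, Q, U)" using growth_inv_run[OF G S s] by auto
  have "reach G S \<subseteq> V" using G S by (intro reach_subset_closed) (auto simp: graph_on_def)
  then have "finite (reach G S)" using G finite_subset by (auto simp: graph_on_def)
  moreover have "P \<subseteq> reach G S" using inv by (auto simp: growth_inv_def)
  ultimately have "P = reach G S" using P by (simp add: card_subset_eq)
  then have "Q = {}" using inv by (auto simp: growth_inv_def)
  then show "card U = card V - card (reach G S)" using run_card(1)[OF G S s] P by simp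
qed

text \<open>A run started inside the closed set \<open>W\<close> never leaves it; the vertices
  outside merely stay unvisited, and intersecting with \<open>W\<close> drops them.\<close>

lemma run_induced_subgraph:
  assumes "\<And>u w. u \<in> W \<Longrightarrow> adj G u w \<Longrightarrow> w \<in> W" "finite Q" "finite U" "Q \<subseteq> W"
  shows "run (induced_subgraph G W) t (P, Q, U \<inter> W) =
         map_pmf (\<lambda>(P, Q, U). (P, Q, U \<inter> W)) (run G t (P, Q, U))"
  using assms(2-)
proof (induction t arbitrary: P Q U)
  case (Suc t)
  let ?H = "induced_subgraph G W"
  show ?case
  proof (cases "Q = {}")
    case False
    have "run ?H t (insert v P, Q - {v} \<union> nbrs ?H v (U \<inter> W), U \<inter> W - nbrs ?H v (U \<inter> W)) =
      map_pmf (\<lambda>(P, Q, U). (P, Q, U \<inter> W)) (run G t (insert v P, Q - {v} \<union> nbrs G v U, U - nbrs G v U))"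
      if "v \<in> Q" for v
    proof -
      have "v \<in> W" using that Suc.prems by auto
      then have N: "nbrs ?H v (U \<inter> W) = nbrs G v U" "nbrs G v U \<subseteq> W"
        using assms(1)[of v] by (auto simp: nbrs_def adj_def induced_subgraph_def)
      have "U \<inter> W - nbrs G v U = (U - nbrs G v U) \<inter> W" by auto
      then show ?thesis unfolding N(1)
        using Suc.prems N(2) by (simp only:) (rule Suc.IH, auto simp: nbrs_def)
    qed
    then show ?thesis using Suc.prems
      unfolding run_Suc_queue[OF False] map_bind_pmf by (intro bind_pmf_cong) (use False in auto)
  qed (simp add: run_empty_queue del: run.simps(2))
qed simp

text \<open>Adjacency is symmetric, so any vertex of a component can serve as its root.\<close>

lemma component_eq_reach:
  assumes G: "graph_on V G" and H: "H \<in> components G" and v: "v \<in> verts H"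
  shows "H = induced_subgraph G (reach G {v})"
proof -
  obtain w where w: "w \<in> V" "H = induced_subgraph G {u \<in> V. (adj G)\<^sup>*\<^sup>* w u}"
    using H G by (auto simp: components_def graph_on_def)
  have wv: "(adj G)\<^sup>*\<^sup>* w v" using v w by (simp add: induced_subgraph_def)
  have "symp (adj G)\<^sup>*\<^sup>*" by (intro symp_rtranclp) (auto simp: symp_def adj_def insert_commute)
  then have vw: "(adj G)\<^sup>*\<^sup>* v w" using wv by (auto dest: sympD)
  have "reach G {w} \<subseteq> V" using G w by (intro reach_subset_closed) (auto simp: graph_on_def)
  then have "{u \<in> V. (adj G)\<^sup>*\<^sup>* w u} = reach G {v}"
    using wv vw by (auto simp: reach_def)
  then show ?thesis using w by simp
qed

text \<open>Transfers the process from the component to the whole graph, whose edges are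
  independent; \<open>P\<close> and \<open>Q\<close> have the same law in both.\<close>

lemma random_growth_component:
  assumes G: "graph_on V G" and H: "H \<in> components G" and v: "v \<in> verts H"
  shows "random_growth H v t = map_pmf (\<lambda>(P, Q, U). (P, Q, U \<inter> verts H)) (run G t ({}, {v}, V - {v}))"
    and "verts H = reach G {v}" and "v \<in> V"
proof -
  have H': "H = induced_subgraph G (reach G {v})" by (rule component_eq_reach[OF assms])
  show vH: "verts H = reach G {v}" by (subst H') (simp add: induced_subgraph_def)
  show "v \<in> V" using G H v by (auto simp: components_def induced_subgraph_def graph_on_def)
  then have "reach G {v} \<subseteq> V" using G by (intro reach_subset_closed) (auto simp: graph_on_def)
  then have U: "reach G {v} - {v} = (V - {v}) \<inter> reach G {v}" by auto
  have "random_growth H v t = run (induced_subgraph G (reach G {v})) t ({}, {v}, (V - {v}) \<inter> reach G {v})"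
    unfolding random_growth_eq_run vH U H'[symmetric] ..
  also have "\<dots> = map_pmf (\<lambda>(P, Q, U). (P, Q, U \<inter> reach G {v})) (run G t ({}, {v}, V - {v}))"
  proof (rule run_induced_subgraph)
    show "w \<in> reach G {v}" if "u \<in> reach G {v}" "adj G u w" for u w
      using that by (rule reach_step)
    show "{v} \<subseteq> reach G {v}" by (rule subset_reach)
  qed (use G in \<open>auto simp: graph_on_def\<close>)
  finally show "random_growth H v t =
    map_pmf (\<lambda>(P, Q, U). (P, Q, U \<inter> verts H)) (run G t ({}, {v}, V - {v}))"
    by (simp only: vH)
qed

lemma largest_component_ge:
  assumes "graph_on V G" "largest_component G H" "v \<in> V"
  shows "card (reach G {v}) \<le> card (verts H)"
proof -
  have "reach G {v} \<subseteq> V" using assms by (intro reach_subset_closed) (auto simp: graph_on_def)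
  then have "reach G {v} = {u \<in> verts G. (adj G)\<^sup>*\<^sup>* v u}"
    using assms(1) by (auto simp: reach_def graph_on_def)
  then have "induced_subgraph G (reach G {v}) \<in> components G"
    using assms by (auto simp: components_def graph_on_def)
  then show ?thesis using assms(2) by (force simp: largest_component_def induced_subgraph_def)
qed

lemma graph_on_gnp: "G \<in> set_pmf (gnp n p) \<Longrightarrow> graph_on {..<n} G"
  by (auto simp: gnp_def graph_on_def adj_def all_edges_def doubleton_eq_iff)

subsection \<open>Real analysis and expectations\<close>

lemma
  fixes d :: real
  assumes d: "d > 1"
  shows delta0_bounds: "0 < delta0 d" "delta0 d < 1"
    and delta0_unique: "\<And>x. 0 < x \<Longrightarrow> x < 1 \<Longrightarrow> 1 - x = exp (- d * x) \<Longrightarrow> x = delta0 d"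
proof -
  have *: "delta0 d \<in> {0<..<1} \<and> 1 - delta0 d = exp (- d * delta0 d)"
    unfolding delta0_def by (rule theI'[OF delta0_ex1[OF d]])
  then show "0 < delta0 d" "delta0 d < 1" by auto
  show "x = delta0 d" if "0 < x" "x < 1" "1 - x = exp (- d * x)" for x
    using delta0_ex1[OF d] * that by (metis greaterThanLessThan_iff)
qed

text \<open>The function vanishes at 0 with slope \<open>d - 1 > 0\<close>, so it is positive just
  to the right of 0. A value \<open>\<le> 0\<close> before \<open>delta0 d\<close> would force a
  second zero in the open unit interval.\<close>

lemma queue_density_pos:
  fixes d x :: real
  assumes d: "d > 1" and x: "0 < x" "x < delta0 d"
  shows "0 < 1 - x - exp (- d * x)"
proof (rule ccontr)
  define f where "f = (\<lambda>x::real. 1 - x - exp (- d * x))"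
  assume "\<not> 0 < 1 - x - exp (- d * x)"
  then have fx: "f x \<le> 0" by (simp add: f_def)
  have "(f has_real_derivative (d - 1)) (at 0)"
    unfolding f_def by (auto intro!: derivative_eq_intros)
  then obtain e where e: "e > 0" "\<And>h. h > 0 \<Longrightarrow> h < e \<Longrightarrow> f 0 < f (0 + h)"
    using DERIV_pos_inc_right[of f "d - 1" 0] d by auto
  define h where "h = min (e / 2) (x / 2)"
  have h: "0 < h" "h < e" "h < x" using e(1) x by (auto simp: h_def min_def)
  have "f h > 0" using e(2)[OF h(1,2)] by (simp add: f_def)
  moreover have "continuous_on {h..x} f" unfolding f_def by (intro continuous_intros)
  ultimately obtain y where y: "h \<le> y" "y \<le> x" "f y = 0"
    using IVT2'[of f x 0 h] fx h by auto
  then have "y = delta0 d" using delta0_unique[OF d, of y] h x delta0_bounds[OF d] by (simp add: f_def)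
  then show False using y x by simp
qed

text \<open>The function is negative at 1, so a value \<open>\<ge> 0\<close> beyond
  \<open>delta0 d\<close> would force a second zero.\<close>

lemma queue_density_neg:
  fixes d x :: real
  assumes d: "d > 1" and x: "delta0 d < x" "x \<le> 1"
  shows "1 - x - exp (- d * x) < 0"
proof (rule ccontr)
  define f where "f = (\<lambda>x::real. 1 - x - exp (- d * x))"
  assume "\<not> 1 - x - exp (- d * x) < 0"
  then have fx: "f x \<ge> 0" by (simp add: f_def)
  have f1: "f 1 < 0" by (simp add: f_def)
  moreover have "continuous_on {x..1} f" unfolding f_def by (intro continuous_intros)
  ultimately obtain y where y: "x \<le> y" "y \<le> 1" "f y = 0"
    using IVT2'[of f 1 0 x] fx x by auto
  have "y \<noteq> 1" using y f1 by auto
  then have "y = delta0 d" using delta0_unique[OF d, of y] y x delta0_bounds[OF d] by (simp add: f_def)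
  then show False using y x by simp
qed

section \<open>Limits at times proportional to \<open>n\<close> and approximation of
  expectations\<close>

lemma nat_floor_ratio_tendsto:
  assumes "0 \<le> \<pi>"
  shows "(\<lambda>n. real (nat \<lfloor>\<pi> * real n\<rfloor>) / real n) \<longlonglongrightarrow> \<pi>"
proof -
  have "(\<lambda>n. real_of_int \<lfloor>\<pi> * real n\<rfloor> / real n) \<longlonglongrightarrow> \<pi>" by real_asymp
  moreover have "real (nat \<lfloor>\<pi> * real n\<rfloor>) = real_of_int \<lfloor>\<pi> * real n\<rfloor>" for n
    using assms by simp
  ultimately show ?thesis by simp
qed

lemma one_minus_div_power_tendsto:
  fixes d :: real
  assumes t: "(\<lambda>n. real (t n) / real n) \<longlonglongrightarrow> \<pi>"
  shows "(\<lambda>n. (1 - d / real n) ^ t n) \<longlonglongrightarrow> exp (- d * \<pi>)"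
proof -
  \<comment> \<open>The power is \<open>exp\<close> of \<open>n * ln (1 - d / n)\<close> times
    \<open>t n / n\<close> once \<open>n > \<bar>d\<bar>\<close>, which makes the base
    positive.\<close>
  have "(\<lambda>n. real n * ln (1 - d / real n)) \<longlonglongrightarrow> - d" by real_asymp
  then have "(\<lambda>n. exp ((real n * ln (1 - d / real n)) * (real (t n) / real n)))
      \<longlonglongrightarrow> exp (- d * \<pi>)"
    by (intro tendsto_exp tendsto_mult t)
  moreover have "\<forall>\<^sub>F n in sequentially. exp ((real n * ln (1 - d / real n)) * (real (t n) / real n))
      = (1 - d / real n) ^ t n"
    using eventually_gt_at_top[of "nat \<lceil>\<bar>d\<bar>\<rceil>"]
  proof eventually_elim
    case (elim n)
    then have n: "\<bar>d\<bar> < real n" "n > 0" by linarith+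
    then have "0 < 1 - d / real n" by (simp add: field_simps)
    then show ?case using n by (simp add: powr_realpow[symmetric] powr_def mult.commute)
  qed
  ultimately show ?thesis by (rule Lim_transform_eventually)
qed

text \<open>The sequence \<open>\<delta>\<close> may depend on \<open>\<eta>\<close>: first
  \<open>\<eta>\<close> is fixed below the target precision, then \<open>n\<close> grows. The error
  has the shape given by \<open>expectation_approx\<close>.\<close>

lemma tendsto_from_approx:
  fixes x L :: "nat \<Rightarrow> real"
  assumes L: "L \<longlonglongrightarrow> l"
    and approx: "\<And>\<eta>. 0 < \<eta> \<Longrightarrow> \<eta> \<le> 1 \<Longrightarrow>
      \<exists>\<delta>. \<delta> \<longlonglongrightarrow> 0 \<and> (\<forall>\<^sub>F n in sequentially. \<bar>x n - L n\<bar> \<le> \<eta> + 2 * \<delta> n)"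
  shows "x \<longlonglongrightarrow> l"
proof (rule tendstoI)
  fix e :: real assume e: "e > 0"
  define \<eta> where "\<eta> = min 1 (e / 4)"
  have \<eta>: "0 < \<eta>" "\<eta> \<le> 1" "\<eta> \<le> e / 4" using e by (auto simp: \<eta>_def)
  obtain \<delta> where \<delta>: "\<delta> \<longlonglongrightarrow> 0" "\<forall>\<^sub>F n in sequentially. \<bar>x n - L n\<bar> \<le> \<eta> + 2 * \<delta> n"
    using approx[OF \<eta>(1,2)] by blast
  have "\<forall>\<^sub>F n in sequentially. dist (\<delta> n) 0 < e / 8"
    using e by (intro tendstoD[OF \<delta>(1)]) simp
  moreover have "\<forall>\<^sub>F n in sequentially. dist (L n) l < e / 4"
    using e by (intro tendstoD[OF L]) simp
  ultimately show "\<forall>\<^sub>F n in sequentially. dist (x n) l < e"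
    using \<delta>(2)
  proof eventually_elim
    case (elim n)
    then show ?case using \<eta>(3) e unfolding dist_real_def by linarith
  qed
qed

text \<open>The error is at most \<open>\<eta>\<close> off \<open>X\<close> and at most 2 on
  \<open>X\<close>; 2 is the crude bound for a density in \<open>[0,1]\<close> against some
  \<open>\<bar>L\<bar> \<le> 1\<close>.\<close>

lemma expectation_approx:
  fixes M :: "'a pmf" and h :: "'a \<Rightarrow> real"
  assumes "\<And>s. s \<in> set_pmf M \<Longrightarrow> \<bar>h s - L\<bar> \<le> 2"
    and "\<And>s. s \<in> set_pmf M \<Longrightarrow> s \<notin> X \<Longrightarrow> \<bar>h s - L\<bar> \<le> \<eta>" and "0 \<le> \<eta>"
  shows "\<bar>measure_pmf.expectation M h - L\<bar> \<le> \<eta> + 2 * measure_pmf.prob M X"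
proof -
  have hL: "integrable M (\<lambda>s. h s - L)"
    using assms(1) by (intro measure_pmf.integrable_const_bound[of _ 2]) (auto simp: AE_measure_pmf_iff)
  then have h: "integrable M h" using Bochner_Integration.integrable_add[OF hL, of "\<lambda>_. L"] by simp
  have "measure_pmf.expectation M h - L = measure_pmf.expectation M (\<lambda>s. h s - L)"
    using h by simp
  also have "\<bar>\<dots>\<bar> \<le> measure_pmf.expectation M (\<lambda>s. \<bar>h s - L\<bar>)"
    by (rule integral_abs_bound)
  also have "\<dots> \<le> measure_pmf.expectation M (\<lambda>s. \<eta> + 2 * indicator X s)"
  proof (rule integral_mono_AE)
    show "AE s in M. \<bar>h s - L\<bar> \<le> \<eta> + 2 * indicator X s"
      unfolding AE_measure_pmf_iff
    proof
      fix s assume "s \<in> set_pmf M"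
      then show "\<bar>h s - L\<bar> \<le> \<eta> + 2 * indicator X s"
        using assms(1)[of s] assms(2)[of s] \<open>0 \<le> \<eta>\<close> by (cases "s \<in> X") auto
    qed
  qed (use hL \<open>0 \<le> \<eta>\<close> in \<open>auto intro!: integrable_abs measure_pmf.integrable_const_bound[of _ "\<eta> + 2"] simp: indicator_def\<close>)
  also have "\<dots> = \<eta> + 2 * measure_pmf.prob M X"
    by (subst Bochner_Integration.integral_add)
      (auto intro!: measure_pmf.integrable_const_bound[of _ 1])
  finally show ?thesis .
qed

subsection \<open>The size of the largest component\<close>

text \<open>If the reached set has exactly \<open>t\<close> vertices, then after \<open>t\<close>
  steps exactly \<open>n - t\<close> are unvisited, at least \<open>n * \<eta>\<close> more than the
  typical \<open>n * (1 - p) ^ t\<close>. This is an upper tail event.\<close>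

lemma reach_size_prob_le:
  fixes n t :: nat and p \<eta> :: real
  assumes p: "0 \<le> p" "p \<le> 1" and S: "S \<subseteq> {..<n}" and \<eta>: "0 < \<eta>" "\<eta> \<le> 1"
    and t: "t \<le> n" "real n * ((1 - p) ^ t + \<eta>) \<le> real n - real t"
  shows "measure_pmf.prob (gnp n p) {G. card (reach G S) = t} \<le> exp (- (real n * \<eta>\<^sup>2 / 8))"
proof -
  let ?X = "{(P, Q, U). card P = t \<and> real (card U) \<ge> real n * ((1 - p) ^ t + \<eta>)} :: nat state set"
  have "emeasure (measure_pmf (gnp n p)) {G. card (reach G S) = t} =
      (\<integral>\<^sup>+G. indicator {G. card (reach G S) = t} G \<partial>gnp n p)"
    by simp
  also have "\<dots> \<le> (\<integral>\<^sup>+G. emeasure (measure_pmf (run G t ({}, S, {..<n} - S))) ?X \<partial>gnp n p)"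
  proof (rule nn_integral_mono_AE, unfold AE_measure_pmf_iff, rule ballI)
    fix G assume "G \<in> set_pmf (gnp n p)"
    note G = graph_on_gnp[OF this]
    show "indicator {G. card (reach G S) = t} G
      \<le> emeasure (measure_pmf (run G t ({}, S, {..<n} - S))) ?X"
    proof (cases "card (reach G S) = t")
      case True
      have "s \<in> ?X" if s: "s \<in> set_pmf (run G t ({}, S, {..<n} - S))" for s
      proof -
        obtain P Q U where PQU: "s = (P, Q, U)" using prod_cases3 by blast
        show ?thesis using run_exhausted[OF G S, of P Q U] s t True
          by (simp add: PQU of_nat_diff)
      qed
      then have "emeasure (measure_pmf (run G t ({}, S, {..<n} - S))) ?X = 1"
        by (intro measure_pmf.emeasure_eq_1_AE) (auto simp: AE_measure_pmf_iff)
      then show ?thesis by (simp add: indicator_def)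
    qed simp
  qed
  also have "\<dots> = emeasure (measure_pmf (exploration n p S t)) ?X"
    by (simp add: exploration_def)
  also have "\<dots> \<le> ennreal (exp (- (real n * \<eta>\<^sup>2 / 8)))"
    by (rule exploration_upper_tail[OF p S \<eta>])
  finally show ?thesis by (simp add: measure_pmf.emeasure_eq_measure)
qed

text \<open>Take the first \<open>k\<close> at which the reached set has at least
  \<open>(b - a) * n\<close> vertices. The vertex added last contributes at most its own component,
  hence at most \<open>a * n\<close>, so the size stays within \<open>b * n\<close>.\<close>

lemma reach_initial_segment_size:
  fixes a b :: real
  assumes G: "graph_on {..<n} G" and n: "n > 0" and ab: "0 < a" "a < b" "b < 1"
    and small: "\<And>v. v < n \<Longrightarrow> real (card (reach G {v})) \<le> a * real n"
  shows "\<exists>k\<le>n. (b - a) * real n \<le> card (reach G {..<k}) \<and> card (reach G {..<k}) \<le> b * real n"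
proof -
  define R where "R = (\<lambda>k. real (card (reach G {..<k})))"
  have sub: "reach G {..<k} \<subseteq> {..<n}" if "k \<le> n" for k
    using G that by (intro reach_subset_closed) (auto simp: graph_on_def)
  have "reach G {..<n} = {..<n}" using sub[of n] subset_reach[of "{..<n}" G] by auto
  then have "R n = real n" by (simp add: R_def)
  moreover have "(b - a) * real n \<le> 1 * real n" using ab by (intro mult_right_mono) auto
  ultimately have Rn: "(b - a) * real n \<le> R n" by simp
  define k where "k = (LEAST k. (b - a) * real n \<le> R k)"
  have k: "(b - a) * real n \<le> R k" unfolding k_def using Rn by (rule LeastI)
  have kn: "k \<le> n" unfolding k_def using Rn by (rule Least_le)
  have "0 < (b - a) * real n" using n ab by simp
  then have "k \<noteq> 0" using k by (intro notI) (simp add: R_def)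
  then obtain j where j: "k = Suc j" by (cases k) auto
  then have "R j < (b - a) * real n" using not_less_Least[of j "\<lambda>k. (b - a) * real n \<le> R k"] by (simp add: k_def)
  moreover have "reach G {..<k} = reach G {j} \<union> reach G {..<j}"
    unfolding j lessThan_Suc by (rule reach_insert)
  then have "R k \<le> card (reach G {j}) + R j"
    unfolding R_def
    using card_Un_le[of "reach G {j}" "reach G {..<j}"] by simp
  moreover have "card (reach G {j}) \<le> a * real n" using small[of j] kn j by simp
  ultimately have "R k \<le> b * real n" by (simp add: algebra_simps)
  then show ?thesis using k kn by (auto simp: R_def)
qed

text \<open>If all components are that small, some initial segment reaches a proportion in
  \<open>[b - a, b]\<close>. The union bound runs over \<open>n + 1\<close> segments and at most
  \<open>n + 1\<close> sizes, each event being exponentially unlikely.\<close>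

lemma small_components_prob_tendsto_0:
  fixes d a :: real
  assumes d: "d > 1" and a: "0 < a" "a < delta0 d"
  shows "(\<lambda>n. measure_pmf.prob (gnp n (d / real n))
           {G. \<forall>v<n. real (card (reach G {v})) \<le> a * real n}) \<longlonglongrightarrow> 0"
proof -
  \<comment> \<open>Any \<open>b\<close> strictly between \<open>a\<close> and
    \<open>delta0 d\<close> puts \<open>[b - a, b]\<close> strictly between 0 and
    \<open>delta0 d\<close>.\<close>
  define b where "b = (a + delta0 d) / 2"
  have b: "a < b" "b < delta0 d" "b < 1" using a delta0_bounds[OF d] by (auto simp: b_def)
  let ?f = "\<lambda>x. 1 - x - exp (- d * x)"
  \<comment> \<open>Compactness gives one positive \<open>\<eta>\<close> for all proportions in the
    interval; the cap at 1 serves the tail bound.\<close>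
  have "continuous_on {b - a..b} ?f" by (intro continuous_intros)
  moreover have "{b - a..b} \<noteq> {}" using a by auto
  ultimately obtain x0 where x0: "x0 \<in> {b - a..b}" "\<And>x. x \<in> {b - a..b} \<Longrightarrow> ?f x0 \<le> ?f x"
    using continuous_attains_inf[of "{b - a..b}" ?f] by auto
  define \<eta> where "\<eta> = min 1 (?f x0)"
  have \<eta>: "0 < \<eta>" "\<eta> \<le> 1" "\<And>x. x \<in> {b - a..b} \<Longrightarrow> \<eta> \<le> ?f x"
    using queue_density_pos[OF d, of x0] x0 b a by (auto simp: \<eta>_def intro: min.coboundedI2)
  define small where "small = (\<lambda>n. {G. \<forall>v<n. real (card (reach G {v})) \<le> a * real n})"
  have bound: "measure_pmf.prob (gnp n (d / real n)) (small n)
      \<le> (real n + 1) * ((real n + 1) * exp (- (real n * \<eta>\<^sup>2 / 8)))" if "real n \<ge> d" for n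
  proof -
    let ?M = "measure_pmf (gnp n (d / real n))"
    have n: "n > 0" "real n > 0" using that d by auto
    define p where "p = d / real n"
    have p: "0 \<le> p" "p \<le> 1" using that d n by (auto simp: p_def)
    define T where "T = {t. t \<le> n \<and> (b - a) * real n \<le> real t \<and> real t \<le> b * real n}"
    have T: "T \<subseteq> {..n}" by (auto simp: T_def)
    define E where "E = (\<lambda>k t. {G. card (reach G {..<k}) = t} :: nat ugraph set)"
    have "measure ?M (small n) \<le> measure ?M (\<Union>k\<in>{..n}. \<Union>t\<in>T. E k t)"
    proof (rule measure_pmf.finite_measure_mono_AE, unfold AE_measure_pmf_iff, intro ballI impI)
      fix G assume "G \<in> set_pmf (gnp n (d / real n))" "G \<in> small n"
      note G = graph_on_gnp[OF this(1)]
      obtain k where k: "k \<le> n" "(b - a) * real n \<le> card (reach G {..<k})" "card (reach G {..<k}) \<le> b * real n"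
        using reach_initial_segment_size[OF G n(1) a(1) b(1,3)] \<open>G \<in> small n\<close> by (auto simp: small_def)
      have "reach G {..<k} \<subseteq> {..<n}"
        using G k(1) by (intro reach_subset_closed) (auto simp: graph_on_def)
      then have "card (reach G {..<k}) \<le> n" using card_mono[of "{..<n}"] by fastforce
      then show "G \<in> (\<Union>k\<in>{..n}. \<Union>t\<in>T. E k t)" using k by (auto simp: T_def E_def)
    qed simp
    also have "\<dots> \<le> (\<Sum>k\<in>{..n}. measure ?M (\<Union>t\<in>T. E k t))"
      by (intro measure_pmf.finite_measure_subadditive_finite) auto
    also have "\<dots> \<le> (\<Sum>k\<in>{..n}. (real n + 1) * exp (- (real n * \<eta>\<^sup>2 / 8)))"
    proof (rule sum_mono)
      fix k assume k: "k \<in> {..n}"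
      have "measure ?M (\<Union>t\<in>T. E k t) \<le> (\<Sum>t\<in>T. measure ?M (E k t))"
        using finite_subset[OF T] by (intro measure_pmf.finite_measure_subadditive_finite) auto
      also have "\<dots> \<le> (\<Sum>t\<in>T. exp (- (real n * \<eta>\<^sup>2 / 8)))"
      proof (rule sum_mono)
        fix t assume t: "t \<in> T"
        \<comment> \<open>By \<open>1 - p \<le> exp (- p)\<close>, the required gap follows from the
          bound by \<open>\<eta>\<close> on \<open>1 - x - exp (- d * x)\<close> at
          \<open>x = t / n\<close>.\<close>
        have "(1 - p) ^ t \<le> exp (- p) ^ t"
          using p exp_ge_add_one_self[of "- p"] by (intro power_mono) auto
        also have "\<dots> = exp (- d * (real t / real n))"
          by (simp add: p_def flip: exp_of_nat_mult)
        also have "\<dots> \<le> 1 - real t / real n - \<eta>"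
          using \<eta>(3)[of "real t / real n"] t n by (auto simp: T_def field_simps)
        finally have "real n * ((1 - p) ^ t + \<eta>) \<le> real n * (1 - real t / real n)"
          using n by (intro mult_left_mono) auto
        also have "\<dots> = real n - real t" using n by (simp add: field_simps)
        finally show "measure ?M (E k t) \<le> exp (- (real n * \<eta>\<^sup>2 / 8))"
          unfolding E_def p_def using t k p \<eta>
          by (intro reach_size_prob_le) (auto simp: T_def p_def)
      qed
      also have "\<dots> = real (card T) * exp (- (real n * \<eta>\<^sup>2 / 8))" by simp
      also have "\<dots> \<le> (real n + 1) * exp (- (real n * \<eta>\<^sup>2 / 8))"
        using card_mono[OF _ T] by (intro mult_right_mono) auto
      finally show "measure ?M (\<Union>t\<in>T. E k t) \<le> (real n + 1) * exp (- (real n * \<eta>\<^sup>2 / 8))" .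
    qed
    also have "\<dots> = (real n + 1) * ((real n + 1) * exp (- (real n * \<eta>\<^sup>2 / 8)))" by (simp add: algebra_simps)
    finally show ?thesis .
  qed
  have "(\<lambda>n. measure_pmf.prob (gnp n (d / real n)) (small n)) \<longlonglongrightarrow> 0"
  proof (rule tendsto_sandwich[OF _ _ tendsto_const])
    show "(\<lambda>n. (real n + 1) * ((real n + 1) * exp (- (real n * \<eta>\<^sup>2 / 8)))) \<longlonglongrightarrow> 0"
      using \<eta>(1) by real_asymp
    show "\<forall>\<^sub>F n in sequentially. measure_pmf.prob (gnp n (d / real n)) (small n)
      \<le> (real n + 1) * ((real n + 1) * exp (- (real n * \<eta>\<^sup>2 / 8)))"
      using eventually_ge_at_top[of "nat \<lceil>d\<rceil>"] by eventually_elim (rule bound, linarith)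
  qed auto
  then show ?thesis by (simp add: small_def)
qed

subsection \<open>Convergence of the queue density\<close>

definition deviating :: "nat \<Rightarrow> real \<Rightarrow> nat \<Rightarrow> real \<Rightarrow> nat state set" where
  "deviating n p t \<eta> = {(P, Q, U). card P = t \<and> \<not> \<bar>real (card U) / real n - (1 - p) ^ t\<bar> < \<eta>}"

lemma emeasure_deviating_le:
  fixes p \<eta> :: real
  assumes p: "0 \<le> p" "p \<le> 1" and v: "v < n" and \<eta>: "0 < \<eta>" "\<eta> \<le> 1"
  shows "emeasure (measure_pmf (exploration n p {v} t)) (deviating n p t \<eta>)
         \<le> ennreal (2 * exp (1 - real n * \<eta>\<^sup>2 / 8))"
proof -
  let ?M = "measure_pmf (exploration n p {v} t)"
  let ?X = "{(P, Q, U). card P = t \<and> real (card U) \<ge> real n * ((1 - p) ^ t + \<eta>)} :: nat state set"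
  let ?Y = "{(P, Q, U). card P = t \<and> real (card U) \<le> real n * ((1 - p) ^ t - \<eta>)} :: nat state set"
  have "deviating n p t \<eta> \<subseteq> ?X \<union> ?Y"
    using v by (auto simp: deviating_def field_simps abs_less_iff not_less)
  then have "emeasure ?M (deviating n p t \<eta>) \<le> emeasure ?M (?X \<union> ?Y)"
    by (intro emeasure_mono) auto
  also have "\<dots> \<le> emeasure ?M ?X + emeasure ?M ?Y"
    by (intro emeasure_subadditive) auto
  also have "\<dots> \<le> ennreal (exp (- (real n * \<eta>\<^sup>2 / 8))) + ennreal (exp (1 - real n * \<eta>\<^sup>2 / 8))"
    using v by (intro add_mono exploration_upper_tail exploration_lower_tail p \<eta>) auto
  also have "\<dots> = ennreal (exp (- (real n * \<eta>\<^sup>2 / 8)) + exp (1 - real n * \<eta>\<^sup>2 / 8))"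
    by simp
  also have "\<dots> \<le> ennreal (2 * exp (1 - real n * \<eta>\<^sup>2 / 8))"
    by (intro ennreal_leI) simp
  finally show ?thesis .
qed

text \<open>\<open>v G\<close> depends on the graph, so its run is not an
  \<open>exploration\<close>. Its deviation is bounded by the sum over all fixed start vertices
  \<open>w < n\<close>, at the price of a factor \<open>n\<close>; graphs in \<open>small\<close>
  are counted in full.\<close>

lemma growth_event_prob_le:
  fixes n t :: nat and p \<eta> :: real
  assumes p: "0 \<le> p" "p \<le> 1" and \<eta>: "0 < \<eta>" "\<eta> \<le> 1"
    and H: "\<And>G. G \<in> set_pmf (gnp n p) \<Longrightarrow> largest_component G (H G)"
    and v: "\<And>G. G \<in> set_pmf (gnp n p) \<Longrightarrow> v G \<in> verts (H G)"
    and R: "\<And>G P Q U. G \<in> set_pmf (gnp n p) \<Longrightarrow> G \<notin> small \<Longrightarrow>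
      (P, Q, U) \<in> set_pmf (run G t ({}, {v G}, {..<n} - {v G})) \<Longrightarrow> R (card Q) \<Longrightarrow>
      (P, Q, U) \<in> deviating n p t \<eta>"
  shows "measure_pmf.prob (bind_pmf (gnp n p) (\<lambda>G. random_growth (H G) (v G) t)) {(P, Q, U). R (card Q)}
         \<le> measure_pmf.prob (gnp n p) small + real n * (2 * exp (1 - real n * \<eta>\<^sup>2 / 8))"
proof -
  let ?X = "{(P, Q, U). R (card Q)} :: nat state set"
  let ?D = "deviating n p t \<eta>"
  let ?r = "\<lambda>G w. measure_pmf (run G t ({}, {w}, {..<n} - {w}))"
  let ?c = "2 * exp (1 - real n * \<eta>\<^sup>2 / 8)"
  have "emeasure (measure_pmf (bind_pmf (gnp n p) (\<lambda>G. random_growth (H G) (v G) t))) ?X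
      = (\<integral>\<^sup>+G. emeasure (measure_pmf (random_growth (H G) (v G) t)) ?X \<partial>gnp n p)"
    by simp
  also have "\<dots> \<le> (\<integral>\<^sup>+G. indicator small G + (\<Sum>w<n. emeasure (?r G w) ?D) \<partial>gnp n p)"
  proof (rule nn_integral_mono_AE, unfold AE_measure_pmf_iff, rule ballI)
    fix G assume G: "G \<in> set_pmf (gnp n p)"
    have comp: "H G \<in> components G" using H[OF G] by (simp add: largest_component_def)
    note rg = random_growth_component[OF graph_on_gnp[OF G] comp v[OF G]]
    show "emeasure (measure_pmf (random_growth (H G) (v G) t)) ?X
      \<le> indicator small G + (\<Sum>w<n. emeasure (?r G w) ?D)"
    proof (cases "G \<in> small")
      case True
      have "emeasure (measure_pmf (random_growth (H G) (v G) t)) ?X \<le> 1"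
        by (rule measure_pmf.emeasure_le_1)
      also have "1 \<le> indicator small G + (\<Sum>w<n. emeasure (?r G w) ?D)"
        using True by (simp add: add_increasing2)
      finally show ?thesis .
    next
      case False
      have "emeasure (measure_pmf (random_growth (H G) (v G) t)) ?X = emeasure (?r G (v G)) ?X"
        by (simp add: rg(1) vimage_def case_prod_unfold)
      also have "\<dots> \<le> emeasure (?r G (v G)) ?D"
        using R[OF G False] by (intro emeasure_mono_AE) (auto simp: AE_measure_pmf_iff)
      also have "\<dots> \<le> (\<Sum>w<n. emeasure (?r G w) ?D)"
        using rg(3) by (intro member_le_sum) auto
      also have "\<dots> \<le> indicator small G + (\<Sum>w<n. emeasure (?r G w) ?D)"
        by (simp add: add_increasing)
      finally show ?thesis .
    qed
  qed
  also have "\<dots> = emeasure (measure_pmf (gnp n p)) small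
      + (\<Sum>w<n. emeasure (measure_pmf (exploration n p {w} t)) ?D)"
    by (simp add: nn_integral_add nn_integral_sum exploration_def)
  also have "\<dots> \<le> emeasure (measure_pmf (gnp n p)) small + (\<Sum>w<n. ennreal ?c)"
    by (intro add_left_mono sum_mono emeasure_deviating_le p \<eta>) auto
  also have "\<dots> = ennreal (measure_pmf.prob (gnp n p) small + real n * ?c)"
    by (simp add: measure_pmf.emeasure_eq_measure ennreal_plus ennreal_mult ennreal_of_nat_eq_real_of_nat)
  finally show ?thesis
    unfolding measure_pmf.emeasure_eq_measure by (subst (asm) ennreal_le_iff) auto
qed

lemma run_queue_density:
  assumes G: "G \<in> set_pmf (gnp n p)" and n: "n > 0" and w: "w < n"
    and s: "(P, Q, U) \<in> set_pmf (run G t ({}, {w}, {..<n} - {w}))" and P: "card P = t"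
  shows "real (card Q) / real n = 1 - real t / real n - real (card U) / real n"
proof -
  have "card P + card Q + card U = n"
    using run_card(1)[OF graph_on_gnp[OF G], of "{w}" P Q U t] w s by simp
  then have "real (card Q) = real n - real t - real (card U)" using P by linarith
  then show ?thesis using n by (simp add: diff_divide_distrib)
qed

lemma random_growth_card_queue_le:
  assumes G: "G \<in> set_pmf (gnp n p)" and H: "H \<in> components G" and v: "v \<in> verts H"
    and s: "(P, Q, U) \<in> set_pmf (random_growth H v t)"
  shows "card Q \<le> n"
proof -
  note rg = random_growth_component[OF graph_on_gnp[OF G] H v]
  obtain U' where "(P, Q, U') \<in> set_pmf (run G t ({}, {v}, {..<n} - {v}))"
    using s by (auto simp: rg(1))
  then have "card P + card Q + card U' = n"
    using run_card(1)[OF graph_on_gnp[OF G], of "{v}" P Q U' t] rg(3) by simp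
  then show ?thesis by simp
qed

text \<open>\<open>H\<close> and \<open>v\<^sub>1\<close> are arbitrary functions of the graph, so
  ties and the start vertex may be resolved adversarially. For \<open>n = 0\<close> there is no
  component, hence the guard \<open>n \<ge> 1\<close>.\<close>

locale growth_on_largest_component =
  fixes d :: real
    and H :: "nat \<Rightarrow> nat ugraph \<Rightarrow> nat ugraph"
    and v\<^sub>1 :: "nat \<Rightarrow> nat ugraph \<Rightarrow> nat"
  assumes d: "d > 1"
    and H: "\<And>n G. n \<ge> 1 \<Longrightarrow> G \<in> set_pmf (gnp n (d / real n)) \<Longrightarrow> largest_component G (H n G)"
    and v\<^sub>1: "\<And>n G. n \<ge> 1 \<Longrightarrow> G \<in> set_pmf (gnp n (d / real n)) \<Longrightarrow> v\<^sub>1 n G \<in> verts (H n G)"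
begin

lemma v\<^sub>1_less:
  assumes "n \<ge> 1" "G \<in> set_pmf (gnp n (d / real n))"
  shows "v\<^sub>1 n G < n"
  using random_growth_component(3)[OF graph_on_gnp[OF assms(2)], of "H n G"] H[OF assms] v\<^sub>1[OF assms]
  by (auto simp: largest_component_def)

text \<open>Joins the split of the expectation with the union bound over start vertices.
  \<open>small\<close> collects exceptional graphs; outside it, an atypical queue must come from an
  atypical \<open>card U\<close> in a live run.\<close>

lemma expected_queue_density_approx:
  fixes \<eta> L :: real
  assumes n: "real n \<ge> d" and \<eta>: "0 < \<eta>" "\<eta> \<le> 1" and L: "\<bar>L\<bar> \<le> 1"
    and dev: "\<And>G P Q U. G \<in> set_pmf (gnp n (d / real n)) \<Longrightarrow> G \<notin> small \<Longrightarrow>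
      (P, Q, U) \<in> set_pmf (run G t ({}, {v\<^sub>1 n G}, {..<n} - {v\<^sub>1 n G})) \<Longrightarrow>
      \<bar>real (card Q) / real n - L\<bar> > \<eta> \<Longrightarrow> (P, Q, U) \<in> deviating n (d / real n) t \<eta>"
  shows "\<bar>expected_queue_density n (d / real n) (H n) (v\<^sub>1 n) t - L\<bar>
    \<le> \<eta> + 2 * (measure_pmf.prob (gnp n (d / real n)) small + real n * (2 * exp (1 - real n * \<eta>\<^sup>2 / 8)))"
proof -
  have n1: "n \<ge> 1" "real n > 0" using n d by auto
  let ?p = "d / real n"
  have p: "0 \<le> ?p" "?p \<le> 1" using n n1 d by auto
  let ?M = "bind_pmf (gnp n ?p) (\<lambda>G. random_growth (H n G) (v\<^sub>1 n G) t)"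
  let ?X = "{(P, Q, U). \<bar>real (card Q) / real n - L\<bar> > \<eta>} :: nat state set"
  let ?h = "\<lambda>(P, Q, U). real (card Q) / real n"
  have "\<bar>measure_pmf.expectation ?M ?h - L\<bar> \<le> \<eta> + 2 * measure_pmf.prob ?M ?X"
  proof (rule expectation_approx)
    fix s assume "s \<in> set_pmf ?M"
    then obtain G where G: "G \<in> set_pmf (gnp n ?p)" "s \<in> set_pmf (random_growth (H n G) (v\<^sub>1 n G) t)"
      by auto
    obtain P Q U where s: "s = (P, Q, U)" using prod_cases3 by blast
    have "card Q \<le> n"
      using random_growth_card_queue_le[OF G(1), of "H n G" "v\<^sub>1 n G" P Q U t] G(2)
        H[OF n1(1) G(1)] v\<^sub>1[OF n1(1) G(1)]
      by (auto simp: s largest_component_def)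
    then have "0 \<le> real (card Q) / real n" "real (card Q) / real n \<le> 1" using n1 by auto
    then have "\<bar>real (card Q) / real n - L\<bar> \<le> 2" using L by linarith
    then show "\<bar>?h s - L\<bar> \<le> 2" by (simp add: s)
    show "\<bar>?h s - L\<bar> \<le> \<eta>" if "s \<notin> ?X" using that by (auto simp: s not_less)
  qed (use \<eta> in simp)
  also have "measure_pmf.prob ?M ?X \<le>
    measure_pmf.prob (gnp n ?p) small + real n * (2 * exp (1 - real n * \<eta>\<^sup>2 / 8))"
    by (rule growth_event_prob_le[OF p \<eta>]) (use H[OF n1(1)] v\<^sub>1[OF n1(1)] dev in auto)
  finally show ?thesis by (simp add: expected_queue_density_def)
qed

lemma error_tendsto_0:
  fixes \<eta> :: real
  assumes "0 < \<eta>"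
  shows "(\<lambda>n. real n * (2 * exp (1 - real n * \<eta>\<^sup>2 / 8))) \<longlonglongrightarrow> 0"
  using assms by real_asymp

lemma eventually_ge_d: "\<forall>\<^sub>F n in sequentially. real n \<ge> d"
  using eventually_ge_at_top[of "nat \<lceil>d\<rceil>"] by eventually_elim linarith

text \<open>With \<open>card P = t\<close> we have \<open>t + card Q + card U = n\<close>, so
  \<open>card Q\<close> and \<open>card U\<close> deviate from their typical values by the same
  amount.\<close>

lemma run_deviating_iff:
  assumes n: "n \<ge> 1" and G: "G \<in> set_pmf (gnp n (d / real n))"
    and s: "(P, Q, U) \<in> set_pmf (run G t ({}, {v\<^sub>1 n G}, {..<n} - {v\<^sub>1 n G}))" and P: "card P = t"
  shows "(P, Q, U) \<in> deviating n (d / real n) t \<eta> \<longleftrightarrow>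
    \<not> \<bar>real (card Q) / real n - (1 - real t / real n - (1 - d / real n) ^ t)\<bar> < \<eta>"
proof -
  have "real (card Q) / real n = 1 - real t / real n - real (card U) / real n"
    using run_queue_density[OF G _ v\<^sub>1_less[OF n G] s P] n by simp
  then show ?thesis using P by (simp add: deviating_def abs_minus_commute)
qed

text \<open>With high probability some component, hence also the largest, has more than
  \<open>\<pi> * n\<close> vertices. Then the run is alive up to the chosen time and the
  concentration of \<open>card U\<close> determines the queue.\<close>

lemma expected_queue_density_subcritical_time:
  assumes \<pi>: "0 < \<pi>" "\<pi> < delta0 d"
  shows "(\<lambda>n. expected_queue_density n (d / real n) (H n) (v\<^sub>1 n) (nat \<lfloor>\<pi> * real n\<rfloor>))
    \<longlonglongrightarrow> 1 - \<pi> - exp (- d * \<pi>)"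
proof (rule tendsto_from_approx)
  define t where "t = (\<lambda>n. nat \<lfloor>\<pi> * real n\<rfloor>)"
  have t_eq: "nat \<lfloor>\<pi> * real n\<rfloor> = t n" for n by (simp add: t_def)
  have t_lim: "(\<lambda>n. real (t n) / real n) \<longlonglongrightarrow> \<pi>"
    unfolding t_def using \<pi> by (intro nat_floor_ratio_tendsto) simp
  show "(\<lambda>n. 1 - real (t n) / real n - (1 - d / real n) ^ t n) \<longlonglongrightarrow> 1 - \<pi> - exp (- d * \<pi>)"
    by (intro tendsto_diff tendsto_const t_lim one_minus_div_power_tendsto)
  fix \<eta> :: real assume \<eta>: "0 < \<eta>" "\<eta> \<le> 1"
  define small where "small = (\<lambda>n. {G. \<forall>v<n. real (card (reach G {v})) \<le> \<pi> * real n})"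
  define \<delta> where "\<delta> = (\<lambda>n. measure_pmf.prob (gnp n (d / real n)) (small n)
    + real n * (2 * exp (1 - real n * \<eta>\<^sup>2 / 8)))"
  have "\<delta> \<longlonglongrightarrow> 0 + 0" unfolding \<delta>_def small_def
    by (intro tendsto_add small_components_prob_tendsto_0 error_tendsto_0 d \<pi> \<eta>)
  moreover have "\<forall>\<^sub>F n in sequentially.
      \<bar>expected_queue_density n (d / real n) (H n) (v\<^sub>1 n) (nat \<lfloor>\<pi> * real n\<rfloor>) -
       (1 - real (t n) / real n - (1 - d / real n) ^ t n)\<bar> \<le> \<eta> + 2 * \<delta> n"
    using eventually_ge_d
  proof eventually_elim
    case (elim n)
    have n: "n \<ge> 1" "real n > 0" using elim d by auto
    show ?case unfolding \<delta>_def t_eq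
    proof (rule expected_queue_density_approx[OF elim \<eta>])
      have "\<pi> * real n \<le> 1 * real n" using \<pi> delta0_bounds[OF d] by (intro mult_right_mono) auto
      then have "t n \<le> n" by (simp add: t_def) linarith
      then have "0 \<le> real (t n) / real n" "real (t n) / real n \<le> 1" using n by auto
      moreover have "0 \<le> 1 - d / real n" "1 - d / real n \<le> 1" using elim n d by auto
      then have "0 \<le> (1 - d / real n) ^ t n" "(1 - d / real n) ^ t n \<le> 1"
        by (auto intro: power_le_one)
      ultimately show "\<bar>1 - real (t n) / real n - (1 - d / real n) ^ t n\<bar> \<le> 1" by linarith
    next
      fix G P Q U
      assume G: "G \<in> set_pmf (gnp n (d / real n))" and "G \<notin> small n"
        and s: "(P, Q, U) \<in> set_pmf (run G (t n) ({}, {v\<^sub>1 n G}, {..<n} - {v\<^sub>1 n G}))"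
        and Q: "\<eta> < \<bar>real (card Q) / real n - (1 - real (t n) / real n - (1 - d / real n) ^ t n)\<bar>"
      obtain v where v: "v < n" "real (card (reach G {v})) > \<pi> * real n"
        using \<open>G \<notin> small n\<close> by (auto simp: small_def not_le)
      have comp: "H n G \<in> components G" using H[OF n(1) G] by (simp add: largest_component_def)
      have "t n \<le> card (reach G {v})" using v(2) by (simp add: t_def) linarith
      also have "\<dots> \<le> card (verts (H n G))"
        using v(1) by (intro largest_component_ge[OF graph_on_gnp[OF G] H[OF n(1) G]]) simp
      also have "verts (H n G) = reach G {v\<^sub>1 n G}"
        using random_growth_component(2)[OF graph_on_gnp[OF G] comp v\<^sub>1[OF n(1) G]] .
      finally have "card P = t n"
        using v\<^sub>1_less[OF n(1) G] by (intro run_alive[OF graph_on_gnp[OF G] _ s]) auto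
      then show "(P, Q, U) \<in> deviating n (d / real n) (t n) \<eta>"
        using run_deviating_iff[OF n(1) G s, of \<eta>] Q by simp
    qed
  qed
  ultimately show "\<exists>\<delta>. \<delta> \<longlonglongrightarrow> 0 \<and> (\<forall>\<^sub>F n in sequentially.
      \<bar>expected_queue_density n (d / real n) (H n) (v\<^sub>1 n) (nat \<lfloor>\<pi> * real n\<rfloor>) -
       (1 - real (t n) / real n - (1 - d / real n) ^ t n)\<bar> \<le> \<eta> + 2 * \<delta> n)"
    by auto
qed

text \<open>A nonempty queue means that the run is alive, and the typical density of a live run is
  eventually negative. A queue density above \<open>\<eta>\<close> is then a deviation by more than
  \<open>\<eta>\<close>.\<close>

lemma expected_queue_density_supercritical_time:
  assumes \<pi>: "delta0 d < \<pi>" "\<pi> \<le> 1"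
  shows "(\<lambda>n. expected_queue_density n (d / real n) (H n) (v\<^sub>1 n) (nat \<lfloor>\<pi> * real n\<rfloor>)) \<longlonglongrightarrow> 0"
proof (rule tendsto_from_approx)
  define t where "t = (\<lambda>n. nat \<lfloor>\<pi> * real n\<rfloor>)"
  have t_eq: "nat \<lfloor>\<pi> * real n\<rfloor> = t n" for n by (simp add: t_def)
  have t_lim: "(\<lambda>n. real (t n) / real n) \<longlonglongrightarrow> \<pi>"
    unfolding t_def using \<pi> delta0_bounds[OF d] by (intro nat_floor_ratio_tendsto) simp
  have "(\<lambda>n. 1 - real (t n) / real n - (1 - d / real n) ^ t n) \<longlonglongrightarrow> 1 - \<pi> - exp (- d * \<pi>)"
    by (intro tendsto_diff tendsto_const t_lim one_minus_div_power_tendsto)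
  then have neg: "\<forall>\<^sub>F n in sequentially. 1 - real (t n) / real n - (1 - d / real n) ^ t n < 0"
    using queue_density_neg[OF d \<pi>] by (rule order_tendstoD)
  show "(\<lambda>_. 0 :: real) \<longlonglongrightarrow> 0" by simp
  fix \<eta> :: real assume \<eta>: "0 < \<eta>" "\<eta> \<le> 1"
  \<comment> \<open>No graph is exceptional in this regime, so \<open>small\<close> is the empty
    set.\<close>
  define \<delta> where "\<delta> = (\<lambda>n. measure_pmf.prob (gnp n (d / real n)) {}
    + real n * (2 * exp (1 - real n * \<eta>\<^sup>2 / 8)))"
  have "\<delta> \<longlonglongrightarrow> 0" using error_tendsto_0[OF \<eta>(1)] by (simp add: \<delta>_def)
  moreover have "\<forall>\<^sub>F n in sequentially.
      \<bar>expected_queue_density n (d / real n) (H n) (v\<^sub>1 n) (nat \<lfloor>\<pi> * real n\<rfloor>) - 0\<bar> \<le> \<eta> + 2 * \<delta> n"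
    using eventually_ge_d neg
  proof eventually_elim
    case (elim n)
    have n: "n \<ge> 1" using elim d by auto
    show ?case unfolding \<delta>_def t_eq
    proof (rule expected_queue_density_approx[OF elim(1) \<eta>])
      fix G P Q U
      assume G: "G \<in> set_pmf (gnp n (d / real n))"
        and s: "(P, Q, U) \<in> set_pmf (run G (t n) ({}, {v\<^sub>1 n G}, {..<n} - {v\<^sub>1 n G}))"
        and Q: "\<eta> < \<bar>real (card Q) / real n - 0\<bar>"
      have "Q \<noteq> {}" using Q \<eta> by auto
      then have "card P = t n"
        using run_card(2)[OF graph_on_gnp[OF G] _ s] v\<^sub>1_less[OF n G] by simp
      then show "(P, Q, U) \<in> deviating n (d / real n) (t n) \<eta>"
        using run_deviating_iff[OF n G s, of \<eta>] Q elim(2) by simp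
    qed simp
  qed
  ultimately show "\<exists>\<delta>. \<delta> \<longlonglongrightarrow> 0 \<and> (\<forall>\<^sub>F n in sequentially.
      \<bar>expected_queue_density n (d / real n) (H n) (v\<^sub>1 n) (nat \<lfloor>\<pi> * real n\<rfloor>) - 0\<bar> \<le> \<eta> + 2 * \<delta> n)"
    by blast
qed

end

theorem mainTheorem9:
  fixes d :: real
    and H :: "nat \<Rightarrow> nat ugraph \<Rightarrow> nat ugraph"
    and v\<^sub>1 :: "nat \<Rightarrow> nat ugraph \<Rightarrow> nat"
  assumes "d > 1"
    and "\<And>n G. n \<ge> 1 \<Longrightarrow> G \<in> set_pmf (gnp n (d / real n)) \<Longrightarrow> largest_component G (H n G)"
    and "\<And>n G. n \<ge> 1 \<Longrightarrow> G \<in> set_pmf (gnp n (d / real n)) \<Longrightarrow> v\<^sub>1 n G \<in> verts (H n G)"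
  shows "(\<forall>\<pi>\<in>{0<..<delta0 d}.
            (\<lambda>n. expected_queue_density n (d / real n) (H n) (v\<^sub>1 n) (nat \<lfloor>\<pi> * real n\<rfloor>))
              \<longlonglongrightarrow> 1 - \<pi> - exp (- d * \<pi>)) \<and>
         (\<forall>\<pi>\<in>{delta0 d<..1}.
            (\<lambda>n. expected_queue_density n (d / real n) (H n) (v\<^sub>1 n) (nat \<lfloor>\<pi> * real n\<rfloor>))
              \<longlonglongrightarrow> 0)"
proof -
  interpret growth_on_largest_component d H v\<^sub>1
    using assms by unfold_locales
  show ?thesis
    using expected_queue_density_subcritical_time expected_queue_density_supercritical_time by simp
qed

end
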